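(* Let $(\mathcal{N},\mathcal{E},\tau)$ be a supply network on a finite directed acyclic graph with delays $\tau_{ij}>0$, in which every ordering node $i$ follows the ordering dynamics given in the context with $K_i>0$, $\beta_i\in[0,1)$ and weights $w_{ij}\ge0$, $\sum_{j\in\mathcal{S}(i)}w_{ij}=1$, and whose nodes are indexed in a topological order. Then for every pair of ordering nodes $\ell,j\in\mathcal{N}\setminus\mathcal{S}_0$, the transfer function $T_{\ell\to j}(s)=o_j(s)/v_\ell(s)$ from exogenous demand at $\ell$ to orders at $j$ satisfies $$T_{\ell\to j}(s)=T_j(s)\sum_{p\in\mathcal{P}_{\ell\to j}}\mathcal{T}_p(s),$$ with the convention that $T_{\ell\to j}(s)=0$ if $\mathcal{P}_{\ell\to j}=\emptyset$.
   Context: Network. $\mathcal{N}$ is a finite node set, $\mathcal{E}\subset\{(u,v):u,v\in\mathcal{N},u\ne v\}$; an edge $(i,j)$ runs from customer $i$ to supplier $j$ and carries a delay $\tau_{ij}>0$ and weight $w_{ij}$. $\mathcal{S}(i)=\{j:(i,j)\in\mathcal{E}\}$ (suppliers), $\mathcal{C}(i)=\{k:(k,i)\in\mathcal{E}\}$ (customers). Sources are $\mathcal{S}_0=\{j:\mathcal{S}(j)=\emptyset\}$; they place no orders. All other nodes are ordering nodes. Topological indexing: nodes are identified with indices so that $(c,j)\in\mathcal{E}$ implies $c<j$. Dynamics of ordering node $i$: $\dot{\mathit{IP}}_i(t)=\sum_{j\in\mathcal{S}(i)}w_{ij}o_i(t-\tau_{ij})-d_i(t)$, $\mathit{SL}_i(t)=\sum_{j\in\mathcal{S}(i)}w_{ij}\int_{t-\tau_{ij}}^t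 o_i(m)\,\mathrm{d}m$, $o_i(t)=d_i(t)-K_i(\mathit{IP}_i(t)+\beta_i\mathit{SL}_i(t))$, $d_i=\sum_{k\in\mathcal{C}(i)}w_{ki}o_k+v_i$, where $v_i$ is exogenous demand, all with zero initial conditions. In the Laplace domain (same symbols for transforms) node $i$ satisfies $o_i=T_i d_i$ with $T_i(s)=\dfrac{s+K_i}{s+K_iW_i(s)}$, $W_i(s)=\beta_i+(1-\beta_i)\sum_{j\in\mathcal{S}(i)}w_{ij}e^{-s\tau_{ij}}$. Network transfer functions: $T_{\ell\to j}(s)=o_j(s)/v_\ell(s)$ when all other exogenous demands are zero, so $o_j=\sum_{\ell\in\mathcal{N}\setminus\mathcal{S}_0}T_{\ell\to j}v_\ell$. Paths: $\mathcal{P}_{\ell\to j}$ is the set of directed paths $p=(\ell,\dots,j)$ whose consecutive nodes are joined by edges of $\mathcal{E}$ (for $\ell=j$ this is the single one-node path $(\ell)$). For $p\in\mathcal{P}_{\ell\to j}$ with edge set $P_e^p$, $\mathcal{T}_p(s)=\bigl(\prod_{e\in P_e^p}w_e\bigr)\bigl(\prod_{n\in p\setminus\{j\}}T_n(s)\bigr)$, i.e. the product of nodal responses over all nodes of $p$ except its last node $j$, with $\mathcal{T}_p(s)=1$ if $p$ has a single node. *)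

theory Defs
  imports "HOL-Analysis.Analysis"
begin

text \<open>An edge \<open>(i, j)\<close> runs from customer \<open>i\<close> to supplier \<open>j\<close>. The fields \<open>delay\<close>, \<open>weight\<close> are
  relevant on edges only, and \<open>gain\<close> (\<open>K\<close>), \<open>smoothing\<close> (\<open>\<beta>\<close>) on ordering nodes only.\<close>

record supply_net =
  nodes :: "nat set"
  edges :: "(nat \<times> nat) set"
  delay :: "nat \<Rightarrow> nat \<Rightarrow> real"
  weight :: "nat \<Rightarrow> nat \<Rightarrow> real"
  gain :: "nat \<Rightarrow> real"
  smoothing :: "nat \<Rightarrow> real"

definition suppliers :: "supply_net \<Rightarrow> nat \<Rightarrow> nat set" where
  "suppliers G i = {j. (i, j) \<in> edges G}"

definition customers :: "supply_net \<Rightarrow> nat \<Rightarrow> nat set" where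
  "customers G i = {k. (k, i) \<in> edges G}"

definition sources :: "supply_net \<Rightarrow> nat set" where
  "sources G = {j \<in> nodes G. suppliers G j = {}}"

definition ordering_nodes :: "supply_net \<Rightarrow> nat set" where
  "ordering_nodes G = nodes G - sources G"

definition supply_network :: "supply_net \<Rightarrow> bool" where
  "supply_network G \<longleftrightarrow>
     finite (nodes G) \<and>
     edges G \<subseteq> {(u, v). u \<in> nodes G \<and> v \<in> nodes G \<and> u \<noteq> v} \<and>
     acyclic (edges G) \<and>
     (\<forall>c j. (c, j) \<in> edges G \<longrightarrow> c < j) \<and>
     (\<forall>i j. (i, j) \<in> edges G \<longrightarrow> delay G i j > 0 \<and> weight G i j \<ge> 0) \<and>
     (\<forall>i \<in> ordering_nodes G. gain G i > 0 \<and> 0 \<le> smoothing G i \<and> smoothing G i < 1 \<and>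
        (\<Sum>j\<in>suppliers G i. weight G i j) = 1)"


text \<open>Signals are functions \<open>nat \<Rightarrow> real \<Rightarrow> real\<close> of node and time; \<open>v\<close> is the exogenous demand,
  \<open>ord\<close> the orders, \<open>IP\<close> the inventory position.\<close>

definition demand :: "supply_net \<Rightarrow> (nat \<Rightarrow> real \<Rightarrow> real) \<Rightarrow> (nat \<Rightarrow> real \<Rightarrow> real) \<Rightarrow> nat \<Rightarrow> real \<Rightarrow> real" where
  "demand G v ord i t = (\<Sum>k\<in>customers G i. weight G k i * ord k t) + v i t"

definition supply_line :: "supply_net \<Rightarrow> (nat \<Rightarrow> real \<Rightarrow> real) \<Rightarrow> nat \<Rightarrow> real \<Rightarrow> real" where
  "supply_line G ord i t =
     (\<Sum>j\<in>suppliers G i. weight G i j * (LINT m:{t - delay G i j..t}|lborel. ord i m))"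

text \<open>The differential equation is required only outside a locally finite set \<open>D\<close> of times, so that
  demands with jumps (e.g. steps), whose jumps reappear in the orders and their delayed copies,
  are admitted. Zero initial conditions: no orders before time \<open>0\<close>, and \<open>IP\<close> starts at \<open>0\<close>.\<close>

definition ordering_dynamics ::
    "supply_net \<Rightarrow> (nat \<Rightarrow> real \<Rightarrow> real) \<Rightarrow> (nat \<Rightarrow> real \<Rightarrow> real) \<Rightarrow> (nat \<Rightarrow> real \<Rightarrow> real) \<Rightarrow> nat \<Rightarrow> bool" where
  "ordering_dynamics G v ord IP i \<longleftrightarrow>
     (\<forall>t<0. ord i t = 0) \<and>
     IP i 0 = 0 \<and>
     continuous_on {0..} (IP i) \<and>
     (\<forall>t\<ge>0. set_integrable lborel {0..t} (ord i)) \<and>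
     (\<exists>D. (\<forall>t. finite (D \<inter> {0..t})) \<and>
        (\<forall>t. t > 0 \<and> t \<notin> D \<longrightarrow>
           (IP i has_real_derivative
              (\<Sum>j\<in>suppliers G i. weight G i j * ord i (t - delay G i j)) - demand G v ord i t)
             (at t))) \<and>
     (\<forall>t\<ge>0. ord i t = demand G v ord i t
                    - gain G i * (IP i t + smoothing G i * supply_line G ord i t))"


definition laplace_converges :: "(real \<Rightarrow> real) \<Rightarrow> complex \<Rightarrow> bool" where
  "laplace_converges f s \<longleftrightarrow>
     set_integrable lborel {0..} (\<lambda>t. exp (- s * of_real t) * complex_of_real (f t))"

definition laplace :: "(real \<Rightarrow> real) \<Rightarrow> complex \<Rightarrow> complex" where
  "laplace f s = (LINT t:{0..}|lborel. exp (- s * of_real t) * complex_of_real (f t))"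


definition node_W :: "supply_net \<Rightarrow> nat \<Rightarrow> complex \<Rightarrow> complex" where
  "node_W G i s = of_real (smoothing G i) + (1 - of_real (smoothing G i)) *
     (\<Sum>j\<in>suppliers G i. of_real (weight G i j) * exp (- s * of_real (delay G i j)))"

definition node_T :: "supply_net \<Rightarrow> nat \<Rightarrow> complex \<Rightarrow> complex" where
  "node_T G i s = (s + of_real (gain G i)) / (s + of_real (gain G i) * node_W G i s)"

definition paths :: "supply_net \<Rightarrow> nat \<Rightarrow> nat \<Rightarrow> nat list set" where
  "paths G l j = {p. p \<noteq> [] \<and> hd p = l \<and> last p = j \<and>
                     successively (\<lambda>a b. (a, b) \<in> edges G) p}"

text \<open>On an acyclic network the vertices of a path are distinct, so products over the sets of its
  edges and of its nodes have one factor per occurrence.\<close>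

definition path_T :: "supply_net \<Rightarrow> nat list \<Rightarrow> complex \<Rightarrow> complex" where
  "path_T G p s =
     (\<Prod>(a, b)\<in>set (zip p (tl p)). of_real (weight G a b)) *
     (\<Prod>n\<in>set p - {last p}. node_T G n s)"

end

theory Submission
  imports Defs
begin

text \<open>Transforming the dynamics of a node gives \<open>o = T d\<close> with \<open>d\<close> the total demand, so the
  transformed orders satisfy a linear recursion along the topological order. The path sums satisfy
  the same recursion, because a path to \<open>j\<close> is \<open>[j]\<close> itself or a path to a customer of \<open>j\<close>
  followed by \<open>j\<close>.\<close>

subsection \<open>Paths\<close>

lemma paths_step:
  "paths G l j = (if j = l then {[l]} else {}) \<union> (\<Union>k\<in>customers G j. (\<lambda>p. p @ [j]) ` paths G l k)"
proof (intro set_eqI iffI)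
  fix p assume "p \<in> paths G l j"
  then have p: "p \<noteq> []" "hd p = l" "last p = j" "successively (\<lambda>a b. (a, b) \<in> edges G) p"
    by (auto simp: paths_def)
  then obtain q where q: "p = q @ [j]"
    by (metis append_butlast_last_id)
  show "p \<in> (if j = l then {[l]} else {}) \<union> (\<Union>k\<in>customers G j. (\<lambda>p. p @ [j]) ` paths G l k)"
  proof (cases "q = []")
    case True
    then show ?thesis using p q by auto
  next
    case False
    then have "last q \<in> customers G j" "q \<in> paths G l (last q)"
      using p q by (auto simp: paths_def customers_def successively_append_iff)
    then show ?thesis using q by blast
  qed
qed (auto simp: paths_def customers_def successively_append_iff split: if_splits)

text \<open>Indices grow along edges, so a path ends at its largest index. This is what makes a node
  appended to a path new.\<close>

lemma set_path_le:
  assumes "\<forall>c j. (c, j) \<in> edges G \<longrightarrow> c < j" and "p \<in> paths G l j" and "x \<in> set p"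
  shows "x \<le> j"
  using assms(2,3)
proof (induction j arbitrary: p rule: less_induct)
  case (less j)
  then show ?case
    using assms(1) by (subst (asm) paths_step) (fastforce simp: customers_def split: if_splits)
qed

section \<open>Finiteness and order in the network\<close>

lemma finite_customers:
  assumes "supply_network G"
  shows "finite (customers G j)"
  using assms unfolding supply_network_def customers_def
  by (elim conjE) (rule finite_subset[of _ "nodes G"], auto)

lemma customer_less:
  assumes "supply_network G" and "k \<in> customers G j"
  shows "k < j"
  using assms by (auto simp: supply_network_def customers_def)

text \<open>A customer has a supplier, so it is no source. Every order entering a demand therefore
  comes from a node that obeys the dynamics.\<close>

lemma customer_ordering:
  assumes "supply_network G" and "k \<in> customers G j"
  shows "k \<in> ordering_nodes G"
  using assms
  by (auto simp: supply_network_def customers_def ordering_nodes_def sources_def suppliers_def)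

lemma delay_nonneg:
  assumes "supply_network G" and "j \<in> suppliers G i"
  shows "0 \<le> delay G i j"
  using assms unfolding supply_network_def suppliers_def mem_Collect_eq
  by (elim conjE) (blast intro: less_imp_le)

text \<open>A sum over an infinite set is 0 by default, so the path sum means what it should only by
  this fact. Customers have smaller indices, which lets the recursion of \<open>paths_step\<close>
  end.\<close>

lemma finite_paths:
  assumes "supply_network G"
  shows "finite (paths G l j)"
proof (induction j rule: less_induct)
  case (less j)
  then show ?case
    using finite_customers[OF assms] customer_less[OF assms] by (subst paths_step) auto
qed

section \<open>Path products and the recursion of path sums\<close>

lemma zip_tl_snoc:
  "p \<noteq> [] \<Longrightarrow> zip (p @ [x]) (tl (p @ [x])) = zip p (tl p) @ [(last p, x)]"
  by (induction p rule: induct_list012) auto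

text \<open>\<open>path_T\<close> multiplies over sets, so the appended edge and node count only if
  they are new, which the topological order ensures. The response of \<open>k\<close> enters here
  because \<open>k\<close> is no longer the last node.\<close>

lemma path_T_snoc:
  assumes "supply_network G" and "k \<in> customers G j" and p: "p \<in> paths G l k"
  shows "path_T G (p @ [j]) s = of_real (weight G k j) * (node_T G k s * path_T G p s)"
proof -
  have pk: "p \<noteq> []" "last p = k" using p by (auto simp: paths_def)
  have "\<forall>c j. (c, j) \<in> edges G \<longrightarrow> c < j" using assms(1) by (simp add: supply_network_def)
  from set_path_le[OF this p] customer_less[OF assms(1,2)] have j: "j \<notin> set p" by fastforce
  \<comment> \<open>An edge of \<open>p\<close> that ends in \<open>j\<close> would put
    \<open>j\<close> on \<open>p\<close>.\<close>
  then have "(k, j) \<notin> set (zip p (tl p))"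
    by (metis list.set_sel(2) set_zip_rightD pk(1))
  then have e: "(\<Prod>(a, b)\<in>set (zip (p @ [j]) (tl (p @ [j]))). complex_of_real (weight G a b)) =
      of_real (weight G k j) * (\<Prod>(a, b)\<in>set (zip p (tl p)). of_real (weight G a b))"
    using pk by (subst zip_tl_snoc) auto
  have "k \<in> set p" using pk last_in_set by blast
  then have set_p: "set (p @ [j]) - {last (p @ [j])} = insert k (set p - {k})"
    using j by auto
  have n: "(\<Prod>n\<in>set (p @ [j]) - {last (p @ [j])}. node_T G n s) =
      node_T G k s * (\<Prod>n\<in>set p - {last p}. node_T G n s)"
    unfolding set_p pk(2) by (subst prod.insert[symmetric]) auto
  show ?thesis
    unfolding path_T_def e n by (simp add: mult_ac)
qed

text \<open>\<open>node_T G k s\<close> times the path sum to \<open>k\<close> is the claimed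
  transfer function to the customer \<open>k\<close>. Multiplied by \<open>node_T G j s\<close>,
  this is thus the recursion of the transformed orders for unit demand at \<open>l\<close>.\<close>

lemma sum_path_T_step:
  assumes G: "supply_network G"
  shows "(\<Sum>p\<in>paths G l j. path_T G p s) = (if j = l then 1 else 0) +
    (\<Sum>k\<in>customers G j. of_real (weight G k j) * (node_T G k s * (\<Sum>p\<in>paths G l k. path_T G p s)))"
proof -
  let ?A = "if j = l then {[l]} else {}"
  let ?B = "\<Union>k\<in>customers G j. (\<lambda>p. p @ [j]) ` paths G l k"
  have "finite ?B" using finite_customers[OF G] finite_paths[OF G] by blast
  \<comment> \<open>\<open>[l]\<close> has one node, an extended path at least two.\<close>
  moreover have "?A \<inter> ?B = {}" by (auto simp: paths_def)
  ultimately have "(\<Sum>p\<in>paths G l j. path_T G p s) =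
      (\<Sum>p\<in>?A. path_T G p s) + (\<Sum>p\<in>?B. path_T G p s)"
    by (subst paths_step) (intro sum.union_disjoint, auto)
  also have "(\<Sum>p\<in>?A. path_T G p s) = (if j = l then 1 else 0)"
    by (simp add: path_T_def)
  \<comment> \<open>The last node but one determines the customer \<open>k\<close>, so the union is
    disjoint.\<close>
  also have "(\<Sum>p\<in>?B. path_T G p s) =
      (\<Sum>k\<in>customers G j. \<Sum>p\<in>(\<lambda>p. p @ [j]) ` paths G l k. path_T G p s)"
    by (intro sum.UNION_disjoint) (auto simp: finite_customers[OF G] finite_paths[OF G], auto simp: paths_def)
  also have "\<dots> = (\<Sum>k\<in>customers G j. \<Sum>p\<in>paths G l k. path_T G (p @ [j]) s)"
    by (intro sum.cong refl sum.reindex[unfolded o_def]) (auto simp: inj_on_def)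
  also have "\<dots> = (\<Sum>k\<in>customers G j. of_real (weight G k j) *
      (node_T G k s * (\<Sum>p\<in>paths G l k. path_T G p s)))"
    by (simp add: path_T_snoc[OF G] sum_distrib_left cong: sum.cong)
  finally show ?thesis .
qed

text \<open>The recursion has only one solution: \<open>Y\<close> at a node is fixed by its values
  at customers, which have smaller indices, and the path sums satisfy the same recursion.\<close>

lemma network_recursion_solution:
  fixes Y :: "nat \<Rightarrow> complex"
  assumes G: "supply_network G"
    and rec: "\<And>i. i \<in> ordering_nodes G \<Longrightarrow>
      Y i = node_T G i s * ((\<Sum>k\<in>customers G i. of_real (weight G k i) * Y k) + (if i = l then V else 0))"
    and "j \<in> ordering_nodes G"
  shows "Y j = V * (node_T G j s * (\<Sum>p\<in>paths G l j. path_T G p s))"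
  using assms(3)
proof (induction j rule: less_induct)
  case (less j)
  have "(\<Sum>k\<in>customers G j. of_real (weight G k j) * Y k) =
    V * (\<Sum>k\<in>customers G j. of_real (weight G k j) * (node_T G k s * (\<Sum>p\<in>paths G l k. path_T G p s)))"
    unfolding sum_distrib_left
    using less.IH customer_less[OF G] customer_ordering[OF G]
    by (intro sum.cong refl) (simp add: sum_distrib_left mult_ac)
  then show ?case
    by (subst rec[OF less.prems], subst sum_path_T_step[OF G]) (simp add: distrib_left add.commute mult.left_commute)
qed

subsection \<open>The Laplace transform\<close>

text \<open>Convergence and value are kept in one relation, so that each rule below transports both;
  the value alone would be a default 0 where the integral diverges.\<close>

definition has_laplace :: "(real \<Rightarrow> real) \<Rightarrow> complex \<Rightarrow> complex \<Rightarrow> bool" where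
  "has_laplace f s F \<longleftrightarrow> has_bochner_integral lborel
     (\<lambda>t. indicator {0..} t *\<^sub>R (exp (- s * of_real t) * complex_of_real (f t))) F"

lemma has_laplace_iff: "has_laplace f s F \<longleftrightarrow> laplace_converges f s \<and> laplace f s = F"
  unfolding has_laplace_def laplace_converges_def laplace_def set_integrable_def
    set_lebesgue_integral_def has_bochner_integral_iff ..

lemma has_laplace_cong:
  assumes "\<And>t. 0 \<le> t \<Longrightarrow> f t = g t"
  shows "has_laplace f s F \<longleftrightarrow> has_laplace g s F"
  unfolding has_laplace_def
  by (rule arg_cong[where f="\<lambda>h. has_bochner_integral lborel h F"])
     (use assms in \<open>auto simp: indicator_def fun_eq_iff\<close>)

lemma has_laplace_add:
  assumes "has_laplace f s F" and "has_laplace g s H"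
  shows "has_laplace (\<lambda>t. f t + g t) s (F + H)"
  using has_bochner_integral_add[OF assms[unfolded has_laplace_def]]
  by (simp add: has_laplace_def algebra_simps)

lemma has_laplace_cmult:
  assumes "has_laplace f s F"
  shows "has_laplace (\<lambda>t. c * f t) s (of_real c * F)"
  using has_bochner_integral_mult_right[OF assms[unfolded has_laplace_def], of "of_real c"]
  by (simp add: has_laplace_def mult_ac)

lemma has_laplace_diff:
  assumes "has_laplace f s F" and "has_laplace g s H"
  shows "has_laplace (\<lambda>t. f t - g t) s (F - H)"
  using has_laplace_add[OF assms(1) has_laplace_cmult[OF assms(2), of "-1"]] by simp

lemma has_laplace_sum:
  assumes "\<And>i. i \<in> I \<Longrightarrow> has_laplace (f i) s (F i)"
  shows "has_laplace (\<lambda>t. \<Sum>i\<in>I. f i t) s (\<Sum>i\<in>I. F i)"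
proof -
  have "has_bochner_integral lborel
      (\<lambda>t. \<Sum>i\<in>I. indicator {0..} t *\<^sub>R (exp (- s * of_real t) * complex_of_real (f i t))) (\<Sum>i\<in>I. F i)"
    using assms by (intro has_bochner_integral_sum) (simp add: has_laplace_def)
  then show ?thesis
    by (simp add: has_laplace_def sum_distrib_left scaleR_sum_right)
qed

text \<open>The substitution t - \<tau> for t shifts the half-line to [\<tau>, \<infinity>). On [0,
  \<tau>) the delayed signal shows only its past before time 0, which vanishes.\<close>

lemma has_laplace_delay:
  assumes F: "has_laplace f s F" and zero: "\<And>t. t < 0 \<Longrightarrow> f t = 0" and "0 \<le> \<tau>"
  shows "has_laplace (\<lambda>t. f (t - \<tau>)) s (exp (- s * of_real \<tau>) * F)"
proof -
  let ?g = "\<lambda>t. indicator {0..} t *\<^sub>R (exp (- s * of_real t) * complex_of_real (f t))"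
  \<comment> \<open>The shift is written as an affine map of slope 1 to fit the substitution
    rules.\<close>
  have "has_bochner_integral lborel (\<lambda>t. ?g (- \<tau> + 1 * t)) F"
    using F lborel_integrable_real_affine[of ?g 1 "- \<tau>"] lborel_integral_real_affine[of 1 ?g "- \<tau>"]
    unfolding has_laplace_def has_bochner_integral_iff by simp
  from has_bochner_integral_mult_right[OF this, of "exp (- s * of_real \<tau>)"]
  have "has_bochner_integral lborel (\<lambda>t. exp (- s * of_real \<tau>) * ?g (- \<tau> + 1 * t)) (exp (- s * of_real \<tau>) * F)"
    by simp
  moreover have "exp (- s * of_real \<tau>) * ?g (- \<tau> + 1 * t) =
      indicator {0..} t *\<^sub>R (exp (- s * of_real t) * complex_of_real (f (t - \<tau>)))" for t
  proof (cases "t < \<tau>")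
    case True
    then show ?thesis using zero[of "t - \<tau>"] by simp
  next
    case False
    then show ?thesis using \<open>0 \<le> \<tau>\<close>
      by (simp add: algebra_simps flip: exp_add)
  qed
  ultimately show ?thesis by (simp add: has_laplace_def)
qed

section \<open>Local integrability and the transform of a primitive\<close>

lemma set_integrable_bounded_mult:
  fixes f g :: "real \<Rightarrow> complex"
  assumes f: "set_integrable lborel {a..b} f" and g: "continuous_on UNIV g"
  shows "set_integrable lborel {a..b} (\<lambda>t. g t * f t)"
proof -
  have "compact (g ` {a..b})"
    by (intro compact_continuous_image continuous_on_subset[OF g]) auto
  then obtain B where B: "\<And>t. t \<in> {a..b} \<Longrightarrow> norm (g t) \<le> B"
    by (force dest!: compact_imp_bounded simp: bounded_iff)
  have [measurable]: "g \<in> borel_measurable borel"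
    using g by (rule borel_measurable_continuous_onI)
  have [measurable]: "(\<lambda>t. indicator {a..b} t *\<^sub>R f t) \<in> borel_measurable lborel"
    using f unfolding set_integrable_def by measurable
  have "integrable lborel (\<lambda>t. g t * (indicator {a..b} t *\<^sub>R f t))"
  proof (rule Bochner_Integration.integrable_bound)
    show "integrable lborel (\<lambda>t. of_real B * (indicator {a..b} t *\<^sub>R f t))"
      using f unfolding set_integrable_def by (intro integrable_mult_right)
    show "AE t in lborel. norm (g t * (indicator {a..b} t *\<^sub>R f t)) \<le>
        norm (of_real B * (indicator {a..b} t *\<^sub>R f t))"
    proof (intro AE_I2)
      fix t
      have "norm (g t) * norm (f t) \<le> \<bar>B\<bar> * norm (f t)" if "t \<in> {a..b}"
        using B[OF that] by (intro mult_right_mono) auto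
      then show "norm (g t * (indicator {a..b} t *\<^sub>R f t)) \<le>
          norm (of_real B * (indicator {a..b} t *\<^sub>R f t))"
        by (cases "t \<in> {a..b}") (simp_all add: norm_mult)
    qed
  qed measurable
  then show ?thesis by (simp add: set_integrable_def)
qed

lemma set_integrable_complex_of_real_iff:
  "set_integrable M A (\<lambda>x. complex_of_real (f x)) \<longleftrightarrow> set_integrable M A f"
proof -
  have "(\<lambda>x. indicator A x *\<^sub>R complex_of_real (f x)) = (\<lambda>x. complex_of_real (indicator A x *\<^sub>R f x))"
    by (simp add: scaleR_conv_of_real)
  then show ?thesis
    unfolding set_integrable_def by (simp only: complex_of_real_integrable_eq)
qed

text \<open>Multiplying the integrand of the transform by \<open>exp (s * of_real t)\<close>, which
  is bounded on a compact interval, recovers \<open>f\<close>.\<close>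

lemma has_laplace_set_integrable:
  assumes "has_laplace f s F"
  shows "set_integrable lborel {0..b} f"
proof -
  have "set_integrable lborel {0..} (\<lambda>t. exp (- s * of_real t) * complex_of_real (f t))"
    using assms by (simp add: has_laplace_iff laplace_converges_def)
  then have "set_integrable lborel {0..b} (\<lambda>t. exp (- s * of_real t) * complex_of_real (f t))"
    by (rule set_integrable_subset) auto
  then have "set_integrable lborel {0..b}
      (\<lambda>t. exp (s * of_real t) * (exp (- s * of_real t) * complex_of_real (f t)))"
    by (rule set_integrable_bounded_mult) (intro continuous_intros)
  then have "set_integrable lborel {0..b} (\<lambda>t. complex_of_real (f t))"
    by (simp add: mult.assoc[symmetric] flip: exp_add)
  then show ?thesis
    by (simp only: set_integrable_complex_of_real_iff)
qed

text \<open>Integration by parts on [0, T]. As \<open>q\<close> is merely integrable, its primitive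
  may fail to be differentiable at some points; instead Fubini exchanges the integrals over the
  triangle 0 \<le> m \<le> t \<le> T.\<close>

lemma laplace_truncated_primitive:
  fixes q :: "real \<Rightarrow> complex"
  assumes T: "0 \<le> T" and q: "set_integrable lborel {0..T} q"
  shows "s * (LINT t:{0..T}|lborel. exp (- s * of_real t) * (LINT m:{0..t}|lborel. q m)) =
    (LINT m:{0..T}|lborel. exp (- s * of_real m) * q m) -
    exp (- s * of_real T) * (LINT m:{0..T}|lborel. q m)"
proof -
  let ?g = "\<lambda>m. indicator {0..T} m *\<^sub>R q m"
  \<comment> \<open>With the factor \<open>s\<close> kept inside,
    \<open>- exp (- s * of_real t)\<close> is an antiderivative even for
    \<open>s = 0\<close>.\<close>
  let ?e = "\<lambda>t. s * exp (- s * of_real t)"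
  let ?I = "\<lambda>t m. indicator {0..T} t *\<^sub>R (if m \<le> t then ?e t else 0) * ?g m"
  have cont: "continuous_on A ?e" for A by (intro continuous_intros)
  have [measurable]: "?e \<in> borel_measurable borel"
    by (intro borel_measurable_continuous_onI cont)
  have int_g: "integrable lborel ?g" using q by (simp add: set_integrable_def)
  then have [measurable]: "?g \<in> borel_measurable lborel" by auto
  have "compact (?e ` {0..T})" by (intro compact_continuous_image cont) auto
  then obtain B where B: "\<And>t. t \<in> {0..T} \<Longrightarrow> norm (?e t) \<le> B"
    by (force dest!: compact_imp_bounded simp: bounded_iff)
  have B0: "0 \<le> B" using B[of 0] T norm_ge_zero order_trans by (metis atLeastAtMost_iff order_refl)
  \<comment> \<open>The integrand is dominated by \<open>B\<close> times the norm of
    \<open>?g\<close> on the square, a product of functions of one variable each.\<close>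
  have int_I: "integrable (lborel \<Otimes>\<^sub>M lborel) (case_prod ?I)"
  proof (rule Bochner_Integration.integrable_bound)
    show "integrable (lborel \<Otimes>\<^sub>M lborel) (\<lambda>(t, m). (indicator {0..T} t * B) *\<^sub>R ?g m)"
    proof (rule lborel_pair.Fubini_integrable)
      show "integrable lborel (\<lambda>t. LINT m|lborel.
          norm (case (t, m) of (t, m) \<Rightarrow> (indicator {0..T} t * B) *\<^sub>R ?g m))"
      proof -
        have "(LINT m|lborel. norm (case (t, m) of (t, m) \<Rightarrow> (indicator {0..T} t * B) *\<^sub>R ?g m)) =
            indicator {0..T} t * (B * (LINT m|lborel. norm (?g m)))" for t
          unfolding prod.case norm_scaleR[of "_ * _"] using B0 by (simp add: abs_mult)
        moreover have "integrable lborel (indicator {0..T} :: real \<Rightarrow> real)"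
          by (simp add: integrable_indicator_iff emeasure_lborel_Icc[OF T])
        ultimately show ?thesis by (simp only:) (intro integrable_mult_left)
      qed
      show "AE t in lborel. integrable lborel
          (\<lambda>m. case (t, m) of (t, m) \<Rightarrow> (indicator {0..T} t * B) *\<^sub>R ?g m)"
        unfolding prod.case using int_g by (intro AE_I2 integrable_scaleR_right)
    qed measurable
    show "AE p in lborel \<Otimes>\<^sub>M lborel. norm (case_prod ?I p) \<le>
        norm (case p of (t, m) \<Rightarrow> (indicator {0..T} t * B) *\<^sub>R ?g m)"
    proof (intro AE_I2, clarify)
      fix t m :: real
      have "norm (indicator {0..T} t *\<^sub>R (if m \<le> t then ?e t else 0)) \<le> indicator {0..T} t * B"
        using B[of t] B0 by (auto simp: indicator_def)
      then have "norm (?I t m) \<le> (indicator {0..T} t * B) * norm (?g m)"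
        unfolding norm_mult by (rule mult_right_mono) simp
      then show "norm (?I t m) \<le> norm ((indicator {0..T} t * B) *\<^sub>R ?g m)"
        using B0 by simp
    qed
  qed measurable
  have inner_m: "(LINT m|lborel. ?I t m) =
      indicator {0..T} t *\<^sub>R (?e t * (LINT m:{0..t}|lborel. q m))" for t
  proof (cases "t \<in> {0..T}")
    case True
    then have "?I t m = ?e t * (indicator {0..t} m *\<^sub>R q m)" for m
      by (auto simp: indicator_def)
    then have "(LINT m|lborel. ?I t m) = (LINT m|lborel. ?e t * (indicator {0..t} m *\<^sub>R q m))"
      by (simp only:)
    also have "\<dots> = ?e t * (LINT m:{0..t}|lborel. q m)"
      unfolding set_lebesgue_integral_def by (rule integral_mult_right_zero)
    finally show ?thesis using True by simp
  qed simp
  \<comment> \<open>For fixed \<open>m\<close> the triangle leaves t in [m, T], and the kernel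
    integrates to a difference of exponentials.\<close>
  have inner_t: "(LINT t|lborel. ?I t m) =
      indicator {0..T} m *\<^sub>R (exp (- s * of_real m) * q m) - exp (- s * of_real T) * ?g m" for m
  proof (cases "m \<in> {0..T}")
    case True
    have "(LINT t|lborel. indicator {m..T} t *\<^sub>R ?e t) =
        - exp (- s * of_real T) - (- exp (- s * of_real m))"
      using True cont
      by (intro integral_FTC_Icc)
        (auto intro!: derivative_eq_intros has_vector_derivative_real_field)
    moreover have "?I t m = (indicator {m..T} t *\<^sub>R ?e t) * q m" for t
      using True by (auto simp: indicator_def)
    ultimately have "(LINT t|lborel. ?I t m) = (exp (- s * of_real m) - exp (- s * of_real T)) * q m"
      by (simp only: integral_mult_left_zero) simp
    then show ?thesis using True by (simp add: algebra_simps)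
  qed simp
  have int_e: "set_integrable lborel {0..T} (\<lambda>m. exp (- s * of_real m) * q m)"
    by (rule set_integrable_bounded_mult[OF q]) (intro continuous_intros)
  have "(LINT t|lborel. LINT m|lborel. ?I t m) = (LINT m|lborel. LINT t|lborel. ?I t m)"
    by (rule lborel_pair.Fubini_integral[OF int_I, symmetric])
  then show ?thesis
    unfolding inner_m inner_t
    using int_e int_g
    by (simp add: set_lebesgue_integral_def set_integrable_def mult.assoc
        flip: mult_scaleR_right)
qed

text \<open>Were the limit nonzero, the norm of \<open>f\<close> would eventually exceed half of its
  norm, and integrability would give a half-line finite measure.\<close>

lemma integrable_tendsto_at_top_imp_zero:
  fixes f :: "real \<Rightarrow> 'a::{banach, second_countable_topology}"
  assumes f: "set_integrable lborel {a..} f" and lim: "(f \<longlongrightarrow> c) at_top"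
  shows "c = 0"
proof (rule ccontr)
  assume "c \<noteq> 0"
  then have "norm c / 2 < norm c" by simp
  with tendsto_norm[OF lim] have "eventually (\<lambda>t. norm c / 2 < norm (f t)) at_top"
    by (rule order_tendstoD)
  then obtain N where N: "\<And>t. t \<ge> N \<Longrightarrow> norm c / 2 < norm (f t)"
    by (auto simp: eventually_at_top_linorder)
  let ?N = "max N a"
  have "set_integrable lborel {?N..} f"
    using f by (rule set_integrable_subset) auto
  then have "integrable lborel (\<lambda>t. indicator {?N..} t * (norm c / 2) :: real)"
    unfolding set_integrable_def
    by (rule Bochner_Integration.integrable_bound)
       (use N in \<open>auto simp: indicator_def intro!: AE_I2 less_imp_le\<close>)
  from integrable_mult_right[OF this, of "2 / norm c"]
  have "integrable lborel (indicator {?N..} :: real \<Rightarrow> real)"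
    using \<open>c \<noteq> 0\<close> by simp
  then have "emeasure lborel {?N..} < \<infinity>"
    by (simp add: integrable_indicator_iff)
  moreover have "emeasure lborel {?N..} = \<infinity>"
  proof (rule ccontr)
    assume fin: "emeasure lborel {?N..} \<noteq> \<infinity>"
    \<comment> \<open>The half-line contains intervals of every length; length one more than its
      supposed finite measure is a contradiction.\<close>
    have "ennreal n \<le> emeasure lborel {?N..}" if "0 \<le> n" for n :: real
      using emeasure_mono[of "{?N..?N + n}" "{?N..}" lborel] that by auto
    from this[of "enn2real (emeasure lborel {?N..}) + 1"] fin show False
      by (cases "emeasure lborel {?N..}") auto
  qed
  ultimately show False by simp
qed

text \<open>The derivative rule without a growth bound on \<open>h\<close>. By the truncated
  identity the boundary term \<open>exp (- s * of_real T) * h T\<close> tends to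
  \<open>Q - s * H\<close>; it is also the integrable integrand of the transform of
  \<open>h\<close>, so the limit is 0.\<close>

lemma has_laplace_primitive:
  assumes q: "has_laplace q s Q" and h: "has_laplace h s H"
    and prim: "\<And>t. 0 \<le> t \<Longrightarrow> h t = (LINT m:{0..t}|lborel. q m)"
  shows "s * H = Q"
proof -
  have trunc: "((\<lambda>T. LINT t:{0..T}|lborel. exp (- s * of_real t) * complex_of_real (f t)) \<longlongrightarrow> F) at_top"
    if f: "has_laplace f s F" for f F
  proof -
    have "set_integrable lborel {0..} (\<lambda>t. exp (- s * of_real t) * complex_of_real (f t))"
      and "(LINT t:{0..}|lborel. exp (- s * of_real t) * complex_of_real (f t)) = F"
      using f by (auto simp: has_laplace_iff laplace_converges_def laplace_def)
    then show ?thesis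
      using tendsto_set_lebesgue_integral_at_top[of 0 lborel] by fastforce
  qed
  have "exp (- s * of_real T) * complex_of_real (h T) =
      (LINT t:{0..T}|lborel. exp (- s * of_real t) * complex_of_real (q t)) -
      s * (LINT t:{0..T}|lborel. exp (- s * of_real t) * complex_of_real (h t))" if "0 \<le> T" for T
  proof -
    have "set_integrable lborel {0..T} (\<lambda>t. complex_of_real (q t))"
      using has_laplace_set_integrable[OF q, of T]
      by (simp only: set_integrable_complex_of_real_iff)
    from laplace_truncated_primitive[OF that this, of s]
    have "s * (LINT t:{0..T}|lborel. exp (- s * of_real t) * of_real (LINT m:{0..t}|lborel. q m)) =
      (LINT m:{0..T}|lborel. exp (- s * of_real m) * of_real (q m)) -
      exp (- s * of_real T) * of_real (LINT m:{0..T}|lborel. q m)"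
      unfolding set_integral_complex_of_real .
    moreover have "(LINT t:{0..T}|lborel. exp (- s * of_real t) * of_real (LINT m:{0..t}|lborel. q m)) =
        (LINT t:{0..T}|lborel. exp (- s * of_real t) * complex_of_real (h t))"
      by (rule set_lebesgue_integral_cong) (auto simp: prim)
    ultimately show ?thesis using prim[OF that] by simp
  qed
  then have "\<forall>\<^sub>F T in at_top. (LINT t:{0..T}|lborel. exp (- s * of_real t) * complex_of_real (q t)) -
      s * (LINT t:{0..T}|lborel. exp (- s * of_real t) * complex_of_real (h t)) =
      exp (- s * of_real T) * complex_of_real (h T)"
    by (intro eventually_mono[OF eventually_ge_at_top[of 0]]) simp
  moreover have "((\<lambda>T. (LINT t:{0..T}|lborel. exp (- s * of_real t) * complex_of_real (q t)) -
      s * (LINT t:{0..T}|lborel. exp (- s * of_real t) * complex_of_real (h t))) \<longlongrightarrow> Q - s * H) at_top"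
    by (intro tendsto_intros trunc q h)
  ultimately have "((\<lambda>T. exp (- s * of_real T) * complex_of_real (h T)) \<longlongrightarrow> Q - s * H) at_top"
    by (rule Lim_transform_eventually[rotated])
  moreover have "set_integrable lborel {0..} (\<lambda>t. exp (- s * of_real t) * complex_of_real (h t))"
    using h by (simp add: has_laplace_iff laplace_converges_def)
  ultimately have "Q - s * H = 0"
    by (rule integrable_tendsto_at_top_imp_zero[rotated])
  then show ?thesis by simp
qed

subsection \<open>Nodal response\<close>

lemma has_laplace_inflow:
  assumes "supply_network G" and "i \<in> ordering_nodes G"
    and "has_laplace (ord i) s Y" and "\<And>t. t < 0 \<Longrightarrow> ord i t = 0"
  shows "has_laplace (\<lambda>t. \<Sum>j\<in>suppliers G i. weight G i j * ord i (t - delay G i j)) s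
    ((\<Sum>j\<in>suppliers G i. of_real (weight G i j) * exp (- s * of_real (delay G i j))) * Y)"
proof -
  have "has_laplace (\<lambda>t. weight G i j * ord i (t - delay G i j)) s
      (of_real (weight G i j) * (exp (- s * of_real (delay G i j)) * Y))" if "j \<in> suppliers G i" for j
    using that assms by (intro has_laplace_cmult has_laplace_delay delay_nonneg) auto
  from has_laplace_sum[OF this] show ?thesis
    by (simp add: sum_distrib_right mult.assoc)
qed

text \<open>Shifting turns the integral of the delayed signal up to t into that of \<open>f\<close>
  up to t - \<tau>, and the window is what remains. This is the integrated form of the balance of
  the supply line.\<close>

lemma set_integral_delay_window:
  fixes f :: "real \<Rightarrow> real"
  assumes f: "\<And>b. set_integrable lborel {0..b} f" and zero: "\<And>t. t < 0 \<Longrightarrow> f t = 0"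
    and "0 \<le> \<tau>" and "0 \<le> t"
  shows "set_integrable lborel {0..t} (\<lambda>m. f (m - \<tau>))"
    and "(LINT m:{t - \<tau>..t}|lborel. f m) =
      (LINT m:{0..t}|lborel. f m) - (LINT m:{0..t}|lborel. f (m - \<tau>))"
proof -
  \<comment> \<open>As \<open>f\<close> vanishes before 0, intervals from 0 may become half-lines;
    this treats t < \<tau> and t \<ge> \<tau> alike.\<close>
  have ind: "indicator {0..b} m *\<^sub>R f m = indicator {..b} m *\<^sub>R f m" for b m
    using zero[of m] by (auto simp: indicator_def)
  have int: "set_integrable lborel {..b} f" for b
    using f[of b] by (simp only: set_integrable_def ind)
  have shift: "indicator {0..t} m *\<^sub>R f (m - \<tau>) = indicator {..t - \<tau>} (- \<tau> + 1 * m) *\<^sub>R f (- \<tau> + 1 * m)" for m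
    using zero[of "m - \<tau>"] \<open>0 \<le> \<tau>\<close> by (auto simp: indicator_def)
  show "set_integrable lborel {0..t} (\<lambda>m. f (m - \<tau>))"
    unfolding set_integrable_def shift
    by (rule lborel_integrable_real_affine[OF int[of "t - \<tau>", unfolded set_integrable_def]]) simp
  have "(LINT m:{0..t}|lborel. f (m - \<tau>)) = (LINT m:{..t - \<tau>}|lborel. f m)"
    unfolding set_lebesgue_integral_def shift
    by (subst (2) lborel_integral_real_affine[of 1 _ "- \<tau>"]) auto
  \<comment> \<open>The endpoint is a null set; dropping it makes the half-line disjoint from the
    closed window.\<close>
  also have "\<dots> = (LINT m:{..<t - \<tau>}|lborel. f m)"
    unfolding set_lebesgue_integral_def
  proof (rule integral_cong_AE)
    show "AE m in lborel. indicator {..t - \<tau>} m *\<^sub>R f m = indicator {..<t - \<tau>} m *\<^sub>R f m"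
      using AE_lborel_singleton[of "t - \<tau>"] by eventually_elim (auto simp: indicator_def)
    show "(\<lambda>m. indicator {..t - \<tau>} m *\<^sub>R f m) \<in> borel_measurable lborel"
      using int[of "t - \<tau>"] unfolding set_integrable_def by auto
    have "set_integrable lborel {..<t - \<tau>} f"
      by (rule set_integrable_subset[OF int[of "t - \<tau>"]]) auto
    then show "(\<lambda>m. indicator {..<t - \<tau>} m *\<^sub>R f m) \<in> borel_measurable lborel"
      unfolding set_integrable_def by auto
  qed
  finally have past: "(LINT m:{0..t}|lborel. f (m - \<tau>)) = (LINT m:{..<t - \<tau>}|lborel. f m)" .
  have "(LINT m:{0..t}|lborel. f m) = (LINT m:{..t}|lborel. f m)"
    by (simp only: set_lebesgue_integral_def ind)
  also have "{..t} = {..<t - \<tau>} \<union> {t - \<tau>..t}" using \<open>0 \<le> \<tau>\<close> by auto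
  also have "(LINT m:{..<t - \<tau>} \<union> {t - \<tau>..t}|lborel. f m) =
      (LINT m:{..<t - \<tau>}|lborel. f m) + (LINT m:{t - \<tau>..t}|lborel. f m)"
  proof (rule set_integral_Un)
    show "set_integrable lborel {..<t - \<tau>} f" "set_integrable lborel {t - \<tau>..t} f"
      by (rule set_integrable_subset[OF int[of t]]; use \<open>0 \<le> \<tau>\<close> in force)+
  qed auto
  finally show "(LINT m:{t - \<tau>..t}|lborel. f m) =
      (LINT m:{0..t}|lborel. f m) - (LINT m:{0..t}|lborel. f (m - \<tau>))"
    using past by simp
qed

text \<open>The gauge integral tolerates finitely many exceptional points when \<open>f\<close> is
  continuous; integrability of \<open>f'\<close> identifies it with the Lebesgue integral.\<close>

lemma set_integral_FTC_locally_finite: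
  fixes f f' :: "real \<Rightarrow> real"
  assumes "continuous_on {a..} f" and "finite (D \<inter> {a..t})" and "a \<le> t"
    and "\<And>x. a < x \<Longrightarrow> x \<notin> D \<Longrightarrow> (f has_real_derivative f' x) (at x)"
    and f': "set_integrable lborel {a..t} f'"
  shows "(LINT x:{a..t}|lborel. f' x) = f t - f a"
proof -
  have "(f' has_integral (f t - f a)) {a..t}"
  proof (rule fundamental_theorem_of_calculus_interior_strong[OF assms(2,3)])
    show "continuous_on {a..t} f" using assms(1) by (rule continuous_on_subset) auto
  qed (use assms(4) in \<open>auto simp: has_real_derivative_iff_has_vector_derivative\<close>)
  then show ?thesis
    using set_borel_integral_eq_integral(2)[OF f'] by (simp add: integral_unique)
qed

text \<open>Only \<open>ord\<close> and the demand are known to have Laplace transforms at \<open>s\<close>, which may lie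
  outside the half-plane where \<open>IP\<close> and the supply line have one. But the control law makes
  \<open>IP + \<beta> SL = (d - o) / K\<close> transformable, so this combination is used instead.\<close>

lemma node_response:
  assumes G: "supply_network G" and i: "i \<in> ordering_nodes G"
    and dyn: "ordering_dynamics G v ord IP i"
    and Y: "has_laplace (ord i) s Y" and D: "has_laplace (demand G v ord i) s D"
    and nz: "s + of_real (gain G i) * node_W G i s \<noteq> 0"
  shows "Y = node_T G i s * D"
proof -
  define K where "K = gain G i"
  define \<beta> where "\<beta> = smoothing G i"
  define inflow where "inflow t = (\<Sum>j\<in>suppliers G i. weight G i j * ord i (t - delay G i j))" for t
  define E where "E = (\<Sum>j\<in>suppliers G i. complex_of_real (weight G i j) * exp (- s * of_real (delay G i j)))"
  define h where "h t = (1 / K) * (demand G v ord i t - ord i t)" for t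
  \<comment> \<open>\<open>q\<close> is the rate of change of IP + \<beta> SL: IP changes at rate
    inflow minus demand, SL at rate orders minus inflow.\<close>
  define q where "q t = (inflow t - demand G v ord i t) + \<beta> * (ord i t - inflow t)" for t
  have K: "0 < K" and w1: "(\<Sum>j\<in>suppliers G i. weight G i j) = 1"
    using G i by (auto simp: supply_network_def K_def)
  have zero: "ord i t = 0" if "t < 0" for t
    using dyn that by (simp add: ordering_dynamics_def)
  have inflow: "has_laplace inflow s (E * Y)"
    using has_laplace_inflow[where ord = ord, OF G i Y zero] by (simp add: inflow_def[abs_def] E_def)
  have int_o: "set_integrable lborel {0..b} (ord i)" for b
    by (rule has_laplace_set_integrable[OF Y])
  have int_in: "set_integrable lborel {0..b} inflow" for b
    by (rule has_laplace_set_integrable[OF inflow])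
  have int_d: "set_integrable lborel {0..b} (demand G v ord i)" for b
    by (rule has_laplace_set_integrable[OF D])

  have IP: "(LINT m:{0..t}|lborel. inflow m - demand G v ord i m) = IP i t" if "0 \<le> t" for t
  proof -
    obtain D where "finite (D \<inter> {0..t})"
      "\<And>t. 0 < t \<Longrightarrow> t \<notin> D \<Longrightarrow> (IP i has_real_derivative inflow t - demand G v ord i t) (at t)"
      using dyn unfolding ordering_dynamics_def inflow_def by blast
    moreover have "continuous_on {0..} (IP i)" "IP i 0 = 0"
      using dyn by (auto simp: ordering_dynamics_def)
    ultimately show ?thesis
      using set_integral_FTC_locally_finite[of 0 "IP i" D t "\<lambda>t. inflow t - demand G v ord i t"]
        set_integral_diff(1)[OF int_in int_d] that by simp
  qed
  \<comment> \<open>Since the weights sum to one, the integrals of \<open>ord i\<close> from all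
    suppliers combine into a single one.\<close>
  have SL: "(LINT m:{0..t}|lborel. ord i m - inflow m) = supply_line G ord i t" if "0 \<le> t" for t
  proof -
    note window = set_integral_delay_window[of "ord i", OF int_o zero delay_nonneg[OF G] \<open>0 \<le> t\<close>]
    have "(LINT m:{0..t}|lborel. inflow m) =
        (\<Sum>j\<in>suppliers G i. LINT m:{0..t}|lborel. weight G i j * ord i (m - delay G i j))"
      unfolding inflow_def set_lebesgue_integral_def scaleR_sum_right
      using window(1) by (intro Bochner_Integration.integral_sum)
        (simp add: set_integrable_def mult.left_commute)
    also have "\<dots> = (\<Sum>j\<in>suppliers G i. weight G i j *
        ((LINT m:{0..t}|lborel. ord i m) - (LINT m:{t - delay G i j..t}|lborel. ord i m)))"
      by (intro sum.cong refl) (simp add: window(2))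
    also have "\<dots> = (LINT m:{0..t}|lborel. ord i m) - supply_line G ord i t"
      by (simp add: supply_line_def right_diff_distrib sum_subtractf w1 flip: sum_distrib_right)
    finally show ?thesis using int_o int_in by simp
  qed
  have prim: "h t = (LINT m:{0..t}|lborel. q m)" if "0 \<le> t" for t
  proof -
    have "(LINT m:{0..t}|lborel. q m) = IP i t + \<beta> * supply_line G ord i t"
      unfolding q_def
      using int_o int_in int_d IP[OF that] SL[OF that] by (subst set_integral_add) auto
    moreover have "ord i t = demand G v ord i t - K * (IP i t + \<beta> * supply_line G ord i t)"
      using dyn that by (simp add: ordering_dynamics_def K_def \<beta>_def)
    ultimately show ?thesis using K by (simp add: h_def)
  qed
  have "has_laplace h s (of_real (1 / K) * (D - Y))"
    unfolding h_def by (intro has_laplace_cmult has_laplace_diff D Y)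
  moreover have "has_laplace q s ((E * Y - D) + of_real \<beta> * (Y - E * Y))"
    unfolding q_def by (intro has_laplace_add has_laplace_cmult has_laplace_diff D Y inflow)
  ultimately have "s * (of_real (1 / K) * (D - Y)) = (E * Y - D) + of_real \<beta> * (Y - E * Y)"
    by (intro has_laplace_primitive[OF _ _ prim])
  then have "s * (D - Y) = of_real K * ((E * Y - D) + of_real \<beta> * (Y - E * Y))"
    using K by (simp add: field_simps)
  moreover have "node_W G i s = of_real \<beta> + (1 - of_real \<beta>) * E"
    by (simp add: node_W_def \<beta>_def E_def)
  \<comment> \<open>Collecting terms, \<open>Y\<close> gets the coefficient s + K (\<beta> + (1 -
    \<beta>) E), in which the bracket is W.\<close>
  ultimately have "(s + of_real K * node_W G i s) * Y = (s + of_real K) * D"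
    by (simp only:) (simp add: algebra_simps)
  then show ?thesis
    using nz by (simp add: node_T_def K_def field_simps)
qed

section \<open>Transfer functions of the network\<close>

theorem theorem5:
  fixes G :: supply_net
    and v ord IP :: "nat \<Rightarrow> real \<Rightarrow> real"
    and l j :: nat
    and s :: complex
  assumes "supply_network G"
    and "l \<in> ordering_nodes G" and "j \<in> ordering_nodes G"
    and "\<forall>i\<in>ordering_nodes G. ordering_dynamics G v ord IP i"
    and "\<forall>k\<in>ordering_nodes G. k \<noteq> l \<longrightarrow> (\<forall>t\<ge>0. v k t = 0)"
    and "\<forall>i\<in>ordering_nodes G. laplace_converges (v i) s \<and> laplace_converges (ord i) s"
    and "\<forall>i\<in>ordering_nodes G. s + of_real (gain G i) * node_W G i s \<noteq> 0"
    and "laplace (v l) s \<noteq> 0"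
  shows "laplace (ord j) s / laplace (v l) s = node_T G j s * (\<Sum>p\<in>paths G l j. path_T G p s)"
proof -
  have ord: "has_laplace (ord i) s (laplace (ord i) s)" if "i \<in> ordering_nodes G" for i
    using assms(6) that by (simp add: has_laplace_iff)
  \<comment> \<open>The other demands are known to vanish only from time 0 on, which is all that the
    transform sees.\<close>
  have v: "has_laplace (v i) s (if i = l then laplace (v l) s else 0)" if "i \<in> ordering_nodes G" for i
  proof (cases "i = l")
    case True
    then show ?thesis using assms(6) that by (simp add: has_laplace_iff)
  next
    case False
    then have "has_laplace (v i) s 0 \<longleftrightarrow> has_laplace (\<lambda>_. 0) s 0"
      using assms(5) that by (intro has_laplace_cong) auto
    moreover have "has_laplace (\<lambda>_. 0) s 0"
      by (simp add: has_laplace_def has_bochner_integral_zero)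
    ultimately show ?thesis using False by simp
  qed
  have "laplace (ord i) s = node_T G i s *
      ((\<Sum>k\<in>customers G i. of_real (weight G k i) * laplace (ord k) s) +
       (if i = l then laplace (v l) s else 0))" if i: "i \<in> ordering_nodes G" for i
  proof (rule node_response[where ord = ord, OF assms(1) i _ ord[OF i]])
    show "has_laplace (demand G v ord i) s
      ((\<Sum>k\<in>customers G i. of_real (weight G k i) * laplace (ord k) s) +
       (if i = l then laplace (v l) s else 0))"
      unfolding demand_def[abs_def]
      by (intro has_laplace_add has_laplace_sum has_laplace_cmult v i ord customer_ordering[OF assms(1)])
  qed (use assms(4,7) i in auto)
  \<comment> \<open>Division by the nonzero \<open>laplace (v l) s\<close> gives the quotient. If no
    path joins \<open>l\<close> to \<open>j\<close>, the sum is empty and the value is 0, as the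
    convention demands.\<close>
  from network_recursion_solution[OF assms(1) this assms(3)] assms(8) show ?thesis
    by simp
qed

end
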